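(* Let $\mathbb{K}=\mathbb{R}$ or $\mathbb{C}$, let $X$ be a first countable, Hausdorff topological vector space over $\mathbb{K}$, let $\mu$ be a non-zero measure on the Borel $\sigma$-algebra of $X$ that is finite on bounded sets, and let $K\subset X$ be a bounded, open neighbourhood of the origin. Let $V\subset X$ be a bounded open neighbourhood of the origin, let $E\subset X$ be topologically dense in $V$, let $u\in X$, and suppose that there exists $(v^{\ast},r^{\ast})\in (E\cap V)\times(0,1)$ such that, for all $\rho\in\mathbb{K}$ with $0<|\rho|<r^{\ast}$, $$\phi(u-v^{\ast},\rho)=\sup_{z\in u-(E\cap V)}\phi(z,\rho).$$ Then $u$ is a local $E$-weak mode of $\mu$ with respect to $V$ if and only if $u$ is a local strong mode of $\mu$ with respect to $V$.
   Context: For $x\in X$ and $\rho\in\mathbb{K}\setminus\{0\}$, put $\phi(x,\rho)=\mu(x+\rho K)\in[0,\infty)$. For $A\subset X$, $u-A=\{u-v: v\in A\}$. $\operatorname{supp}(\mu)$ is the set of points all of whose open neighbourhoods have positive $\mu$-measure. Limits as $|\rho|\to0$ are over $\rho\in\mathbb{K}\setminus\{0\}$. Suprema take values in $[0,\infty]$, and a ratio with denominator $0$ is taken to be $+\infty$ (so that $0/0$ never counts as satisfying a mode condition). "$E$ is topologically dense in $V$" means that $E\cap V$ is dense in $V$. A local strong mode of $\mu$ with respect to $V$ is any $u\in X$ such that $\lim_{|\rho|\to0}\frac{\sup_{z\in u-V}\phi(z,\rho)}{\phi(u,\rho)}=1$. A local $E$-weak mode of $\mu$ with respect to $V$ is any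 $u\in\operatorname{supp}(\mu)$ such that $\limsup_{|\rho|\to0}\frac{\phi(u-v,\rho)}{\phi(u,\rho)}\le1$ for every $v\in E\cap V$. *)

theory Defs
  imports "HOL-Analysis.Analysis"
begin

text \<open>The scalar field is \<open>\<real>\<close> or \<open>\<complex>\<close> with its usual absolute value: up to isometric field
  isomorphism, the types of the following class are exactly \<^typ>\<open>real\<close> and \<^typ>\<open>complex\<close>.\<close>

class real_or_complex = real_normed_field +
  assumes iso_real_or_complex:
    "\<exists>f :: 'a \<Rightarrow> complex. f 1 = 1 \<and> (\<forall>x y. f (x + y) = f x + f y) \<and> (\<forall>x y. f (x * y) = f x * f y) \<and>
       (\<forall>x. norm (f x) = norm x) \<and> (range f = \<real> \<or> range f = UNIV)"

instance real :: real_or_complex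
  by intro_classes (rule exI[of _ complex_of_real], auto simp: Reals_def)

instance complex :: real_or_complex
  by intro_classes (rule exI[of _ id], auto)

text \<open>Continuity of addition is part of the class \<^class>\<open>topological_ab_group_add\<close>.\<close>

locale topological_vector_space = vector_space smul
  for smul :: "'k::real_or_complex \<Rightarrow> 'a::topological_ab_group_add \<Rightarrow> 'a" +
  assumes continuous_smul: "continuous_on UNIV (\<lambda>(c, x). smul c x)"

text \<open>Boundedness in the sense of von Neumann. The constant \<^const>\<open>bounded\<close> of the library
  needs a metric.\<close>

definition tvs_bounded :: "('k::real_or_complex \<Rightarrow> 'a::topological_ab_group_add \<Rightarrow> 'a) \<Rightarrow> 'a set \<Rightarrow> bool"
  where "tvs_bounded smul B \<longleftrightarrow>
    (\<forall>U. open U \<and> 0 \<in> U \<longrightarrow> (\<exists>r>0. \<forall>c. r < norm c \<longrightarrow> B \<subseteq> smul c ` U))"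

definition phi :: "('k::real_or_complex \<Rightarrow> 'a::topological_ab_group_add \<Rightarrow> 'a) \<Rightarrow> 'a measure \<Rightarrow> 'a set
    \<Rightarrow> 'a \<Rightarrow> 'k \<Rightarrow> ennreal"
  where "phi smul \<mu> K x \<rho> = emeasure \<mu> ((\<lambda>k. x + smul \<rho> k) ` K)"

text \<open>Division on \<^typ>\<open>ennreal\<close> has \<open>0 / 0 = 0\<close>, whereas a ratio with denominator \<open>0\<close> must
  never satisfy a mode condition.\<close>

definition ratio :: "ennreal \<Rightarrow> ennreal \<Rightarrow> ennreal"
  where "ratio a b = (if b = 0 then \<infinity> else a / b)"

definition measure_supp :: "'a::topological_space measure \<Rightarrow> 'a set"
  where "measure_supp \<mu> = {x. \<forall>U. open U \<and> x \<in> U \<longrightarrow> emeasure \<mu> U > 0}"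

definition local_strong_mode :: "('k::real_or_complex \<Rightarrow> 'a::topological_ab_group_add \<Rightarrow> 'a) \<Rightarrow> 'a measure
    \<Rightarrow> 'a set \<Rightarrow> 'a set \<Rightarrow> 'a \<Rightarrow> bool"
  where "local_strong_mode smul \<mu> K V u \<longleftrightarrow>
    ((\<lambda>\<rho>. ratio (SUP z \<in> {u - v | v. v \<in> V}. phi smul \<mu> K z \<rho>) (phi smul \<mu> K u \<rho>)) \<longlongrightarrow> 1) (at 0)"

definition local_weak_mode :: "('k::real_or_complex \<Rightarrow> 'a::topological_ab_group_add \<Rightarrow> 'a) \<Rightarrow> 'a measure
    \<Rightarrow> 'a set \<Rightarrow> 'a set \<Rightarrow> 'a set \<Rightarrow> 'a \<Rightarrow> bool"
  where "local_weak_mode smul \<mu> K E V u \<longleftrightarrow>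
    u \<in> measure_supp \<mu> \<and>
    (\<forall>v \<in> E \<inter> V. Limsup (at 0) (\<lambda>\<rho>. ratio (phi smul \<mu> K (u - v) \<rho>) (phi smul \<mu> K u \<rho>)) \<le> 1)"

end

theory Submission
  imports Defs
begin

text \<open>Writing \<open>\<phi>(x, \<rho>) = \<mu>(x + \<rho>K)\<close>, the point is that for fixed \<open>\<rho> \<noteq> 0\<close> the function \<open>\<phi>(\<cdot>, \<rho>)\<close> is
  lower semicontinuous, because \<open>K\<close> is open: if \<open>z\<^sub>n \<rightarrow> x\<close>, every point of \<open>x + \<rho>K\<close> lies in all but
  finitely many of the sets \<open>z\<^sub>n + \<rho>K\<close>, and continuity of \<open>\<mu>\<close> from below gives
  \<open>\<phi>(x, \<rho>) \<le> sup\<^sub>n \<phi>(z\<^sub>n, \<rho>)\<close> (lemma \<open>phi_limit_le\<close>). A supremum of such a function over a set is the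
  same as over its closure, so the supremum over the dense set \<open>u - (E \<inter> V)\<close> is the supremum over
  \<open>u - V\<close> (lemma \<open>SUP_phi_dense\<close>). Sequences suffice because \<open>X\<close> is first countable.

  If \<open>v\<close> dominates, the ratio in the definition of a strong mode is therefore, for small \<open>\<rho>\<close>, the
  ratio of \<open>\<phi>(u - v, \<rho>)\<close> to \<open>\<phi>(u, \<rho>)\<close>. At a weak mode its limit superior is at most \<open>1\<close>, and it is
  never below \<open>1\<close>, because \<open>u\<close> itself belongs to \<open>u - V\<close> and \<open>\<phi>(u, \<rho>)\<close> is finite
  (lemma \<open>phi_finite\<close>); so it tends to \<open>1\<close>. Conversely, at a strong mode each ratio in the
  definition of a weak mode is bounded by one that tends to \<open>1\<close>. Moreover \<open>u\<close> is in the support: since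
  \<open>K\<close> is bounded, the sets \<open>u + \<rho>K\<close> shrink into any neighbourhood of \<open>u\<close> (lemma
  \<open>eventually_scaled_translate_subset\<close>), and if one such neighbourhood were null, the ratio would be
  \<open>\<infinity>\<close> for all small \<open>\<rho>\<close>.\<close>

section \<open>Scaled translates in a topological vector space\<close>

context topological_vector_space
begin

lemma tendsto_smul:
  assumes "(f \<longlongrightarrow> c) F" "(g \<longlongrightarrow> x) F"
  shows "((\<lambda>t. smul (f t) (g t)) \<longlongrightarrow> smul c x) F"
proof -
  from continuous_on_tendsto_compose[OF continuous_smul tendsto_Pair[OF assms]]
  show ?thesis
    by simp
qed

lemma scaled_translate_eq_vimage:
  assumes "\<rho> \<noteq> 0"
  shows "(\<lambda>k. x + smul \<rho> k) ` K = (\<lambda>y. smul (inverse \<rho>) (y - x)) -` K"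
proof (intro set_eqI iffI)
  fix y assume "y \<in> (\<lambda>y. smul (inverse \<rho>) (y - x)) -` K"
  moreover have "y = x + smul \<rho> (smul (inverse \<rho>) (y - x))"
    using assms by simp
  ultimately show "y \<in> (\<lambda>k. x + smul \<rho> k) ` K"
    by blast
qed (use assms in auto)

lemma open_scaled_translate:
  assumes "open K" "\<rho> \<noteq> 0"
  shows "open ((\<lambda>k. x + smul \<rho> k) ` K)"
proof -
  have "continuous_on UNIV (\<lambda>y. smul (inverse \<rho>) (y - x))"
    unfolding continuous_on_def by (intro ballI tendsto_smul tendsto_intros)
  then show ?thesis
    unfolding scaled_translate_eq_vimage[OF assms(2)] by (rule open_vimage[OF assms(1)])
qed

lemma eventually_scaled_translate_subset:
  assumes "tvs_bounded smul K" "open U" "x \<in> U"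
  shows "\<forall>\<^sub>F \<rho> in at 0. (\<lambda>k. x + smul \<rho> k) ` K \<subseteq> U"
proof -
  let ?U = "(\<lambda>y. x + y) -` U"
  have "open ?U" "0 \<in> ?U"
    using assms(2,3) by (auto intro!: open_vimage continuous_intros)
  then obtain r where r: "r > 0" "\<And>c. r < norm c \<Longrightarrow> K \<subseteq> smul c ` ?U"
    using assms(1) unfolding tvs_bounded_def by meson
  have sub: "(\<lambda>k. x + smul \<rho> k) ` K \<subseteq> U" if \<rho>: "\<rho> \<noteq> 0" "norm \<rho> < inverse r" for \<rho>
  proof -
    have "r < norm (inverse \<rho>)"
      using \<rho> r(1) by (simp add: norm_inverse norm_divide field_simps)
    then have "K \<subseteq> smul (inverse \<rho>) ` ?U"
      by (rule r(2))
    then show ?thesis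
      using \<rho>(1) by fastforce
  qed
  show ?thesis
    unfolding eventually_at using r(1) sub
    by (intro exI[of _ "inverse r"]) (auto simp: dist_norm)
qed

text \<open>Finiteness on bounded sets makes \<open>\<phi>\<close> finite through this closure property: if
  \<open>W + W \<subseteq> U\<close>, then for large \<open>c\<close> both \<open>x\<close> and \<open>\<rho>K\<close> are absorbed by \<open>cW\<close>, so their sum is
  absorbed by \<open>cU\<close>.\<close>

lemma tvs_bounded_scaled_translate:
  assumes K: "tvs_bounded smul K" and \<rho>: "\<rho> \<noteq> 0"
  shows "tvs_bounded smul ((\<lambda>k. x + smul \<rho> k) ` K)"
  unfolding tvs_bounded_def
proof (intro allI impI)
  fix U :: "'a set" assume U: "open U \<and> 0 \<in> U"
  have "((\<lambda>p. fst p + snd p) \<longlongrightarrow> 0 + 0) (nhds (0::'a) \<times>\<^sub>F nhds 0)"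
    by (intro tendsto_add filterlim_fst filterlim_snd)
  then have "\<forall>\<^sub>F p in nhds (0::'a) \<times>\<^sub>F nhds 0. fst p + snd p \<in> U"
    using U by (intro topological_tendstoD) auto
  then obtain P Q where PQ: "eventually P (nhds (0::'a))" "eventually Q (nhds (0::'a))"
      "\<And>a b. P a \<Longrightarrow> Q b \<Longrightarrow> a + b \<in> U"
    unfolding eventually_prod_filter by auto
  obtain A B where AB: "open A" "0 \<in> A" "\<And>a. a \<in> A \<Longrightarrow> P a"
      "open B" "0 \<in> B" "\<And>b. b \<in> B \<Longrightarrow> Q b"
    using PQ(1,2) unfolding eventually_nhds by blast
  obtain r where r: "r > 0" "\<And>c. r < norm c \<Longrightarrow> K \<subseteq> smul c ` B"
    using K AB(4,5) unfolding tvs_bounded_def by meson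
  have "((\<lambda>c. smul c x) \<longlongrightarrow> smul 0 x) (at 0)"
    by (intro tendsto_smul tendsto_intros)
  then have "\<forall>\<^sub>F c in at 0. smul c x \<in> A"
    using AB(1,2) by (intro topological_tendstoD) auto
  then obtain d where d: "d > 0" "\<And>c. c \<noteq> 0 \<Longrightarrow> norm c < d \<Longrightarrow> smul c x \<in> A"
    unfolding eventually_at by (auto simp: dist_norm)
  let ?s = "max (inverse d) (r * norm \<rho>)"
  show "\<exists>s>0. \<forall>c. s < norm c \<longrightarrow> (\<lambda>k. x + smul \<rho> k) ` K \<subseteq> smul c ` U"
  proof (intro exI[of _ ?s] conjI allI impI subsetI)
    show "0 < ?s"
      using d(1) by (simp add: less_max_iff_disj)
    fix c :: 'k and y assume c: "?s < norm c" and y: "y \<in> (\<lambda>k. x + smul \<rho> k) ` K"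
    have "0 < norm c"
      using \<open>0 < ?s\<close> c by (rule less_trans)
    then have c0: "c \<noteq> 0"
      by simp
    obtain k where k: "k \<in> K" "y = x + smul \<rho> k"
      using y by blast
    have "norm (inverse c) < d"
      using c d(1) c0 by (simp add: norm_inverse norm_divide field_simps)
    then have a: "smul (inverse c) x \<in> A"
      using c0 by (intro d(2)) auto
    have "r < norm (c / \<rho>)"
      using c \<rho> by (simp add: norm_divide field_simps)
    then have "k \<in> smul (c / \<rho>) ` B"
      using r(2) k(1) by blast
    then obtain b where b: "b \<in> B" "k = smul (c / \<rho>) b"
      by blast
    have "y = smul c (smul (inverse c) x + b)"
      using \<rho> c0 by (simp add: k(2) b(2) scale_right_distrib)
    moreover have "smul (inverse c) x + b \<in> U"
      using PQ(3) AB(3,6) a b(1) by blast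
    ultimately show "y \<in> smul c ` U"
      by blast
  qed
qed

lemma phi_finite:
  assumes "\<And>B. B \<in> sets borel \<Longrightarrow> tvs_bounded smul B \<Longrightarrow> emeasure \<mu> B < \<infinity>"
    and "open K" "tvs_bounded smul K" "\<rho> \<noteq> 0"
  shows "phi smul \<mu> K x \<rho> < \<infinity>"
  unfolding phi_def
  by (intro assms(1) tvs_bounded_scaled_translate borel_open open_scaled_translate assms(2-4))

section \<open>Lower semicontinuity\<close>

text \<open>Lower semicontinuity of \<open>\<phi>(\<cdot>, \<rho>)\<close> along sequences: as \<open>K\<close> is open, \<open>x + \<rho>K\<close> is contained in
  the set-theoretic limit inferior of the sets \<open>z\<^sub>n + \<rho>K\<close>.\<close>

lemma phi_limit_le:
  assumes borel: "sets \<mu> = sets borel" and K: "open K" and \<rho>: "\<rho> \<noteq> 0"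
    and lim: "z \<longlonglongrightarrow> x" and le: "\<And>n. phi smul \<mu> K (z n) \<rho> \<le> C"
  shows "phi smul \<mu> K x \<rho> \<le> C"
proof -
  define S where "S y = (\<lambda>k. y + smul \<rho> k) ` K" for y
  have meas: "S y \<in> sets \<mu>" for y
    using open_scaled_translate[OF K \<rho>] by (simp add: S_def borel)
  define T where "T n = (\<Inter>m\<in>{n..}. S (z m))" for n
  have T_sets: "T n \<in> sets \<mu>" for n
    unfolding T_def using meas by (intro sets.countable_INT') auto
  have "incseq T"
    by (rule incseq_SucI) (auto simp: T_def)
  have "S x \<subseteq> (\<Union>n. T n)"
  proof
    fix y assume "y \<in> S x"
    then have "smul (inverse \<rho>) (y - x) \<in> K"
      by (simp add: S_def scaled_translate_eq_vimage[OF \<rho>])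
    moreover have "(\<lambda>n. smul (inverse \<rho>) (y - z n)) \<longlonglongrightarrow> smul (inverse \<rho>) (y - x)"
      by (intro tendsto_smul tendsto_intros lim)
    ultimately have "\<forall>\<^sub>F n in sequentially. smul (inverse \<rho>) (y - z n) \<in> K"
      using K by (intro topological_tendstoD)
    then show "y \<in> (\<Union>n. T n)"
      by (auto simp: T_def S_def scaled_translate_eq_vimage[OF \<rho>] eventually_sequentially)
  qed
  then have "emeasure \<mu> (S x) \<le> emeasure \<mu> (\<Union>n. T n)"
    using T_sets by (intro emeasure_mono) auto
  also have "\<dots> = (SUP n. emeasure \<mu> (T n))"
    using T_sets \<open>incseq T\<close> by (intro SUP_emeasure_incseq[symmetric]) auto
  also have "\<dots> \<le> C"
  proof (rule SUP_least)
    fix n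
    have "emeasure \<mu> (T n) \<le> emeasure \<mu> (S (z n))"
      using meas by (intro emeasure_mono) (auto simp: T_def)
    also have "\<dots> \<le> C"
      using le by (simp add: S_def phi_def)
    finally show "emeasure \<mu> (T n) \<le> C" .
  qed
  finally show ?thesis
    by (simp add: S_def phi_def)
qed

end

lemma SUP_phi_dense:
  fixes smul :: "'k::real_or_complex \<Rightarrow>
      'a::{topological_ab_group_add, first_countable_topology} \<Rightarrow> 'a"
  assumes tvs: "topological_vector_space smul"
    and borel: "sets \<mu> = sets borel" and K: "open K" and \<rho>: "\<rho> \<noteq> 0"
    and "D \<subseteq> V" and dense: "V \<subseteq> closure D"
  shows "(SUP z \<in> {u - w | w. w \<in> D}. phi smul \<mu> K z \<rho>) = (SUP z \<in> {u - v | v. v \<in> V}. phi smul \<mu> K z \<rho>)"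
    (is "?sD = ?sV")
proof (rule antisym)
  interpret topological_vector_space smul by (rule tvs)
  show "?sD \<le> ?sV"
    using \<open>D \<subseteq> V\<close> by (intro SUP_subset_mono) auto
  show "?sV \<le> ?sD"
  proof (rule SUP_least, clarify)
    fix v assume "v \<in> V"
    then have "v \<in> closure D"
      using dense by blast
    then obtain w where w: "\<And>n. w n \<in> D" "w \<longlonglongrightarrow> v"
      unfolding closure_sequential by blast
    show "phi smul \<mu> K (u - v) \<rho> \<le> ?sD"
    proof (rule phi_limit_le[OF borel K \<rho>])
      show "(\<lambda>n. u - w n) \<longlonglongrightarrow> u - v"
        by (intro tendsto_intros w(2))
      show "phi smul \<mu> K (u - w n) \<rho> \<le> ?sD" for n
        using w(1) by (intro SUP_upper) auto
    qed
  qed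
qed

section \<open>Weak and strong modes\<close>

lemma ratio_mono: "a \<le> b \<Longrightarrow> ratio a c \<le> ratio b c"
  by (simp add: ratio_def divide_right_mono_ennreal)

text \<open>Finiteness of the denominator matters: the quotient of \<open>\<infinity>\<close> by itself is \<open>0\<close> in
  \<^typ>\<open>ennreal\<close>.\<close>

lemma one_le_ratio:
  assumes "b \<le> a" "b < \<infinity>"
  shows "1 \<le> ratio a b"
proof (cases "b = 0")
  case False
  then have "1 = b / b"
    using assms(2) by (simp add: ennreal_divide_self)
  also have "\<dots> \<le> a / b"
    using assms(1) by (rule divide_right_mono_ennreal)
  finally show ?thesis
    using False by (simp add: ratio_def)
qed (simp add: ratio_def)

theorem theorem5p4:
  fixes smul :: "'k::real_or_complex \<Rightarrow>
      'a::{topological_ab_group_add, first_countable_topology, t2_space} \<Rightarrow> 'a"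
    and \<mu> :: "'a measure"
    and K V E :: "'a set"
    and u :: 'a
  assumes tvs: "topological_vector_space smul"
    and borel: "sets \<mu> = sets borel"
    and nonzero: "emeasure \<mu> UNIV \<noteq> 0"
    and finite_bounded: "\<And>B. B \<in> sets borel \<Longrightarrow> tvs_bounded smul B \<Longrightarrow> emeasure \<mu> B < \<infinity>"
    and K: "open K" "0 \<in> K" "tvs_bounded smul K"
    and V: "open V" "0 \<in> V" "tvs_bounded smul V"
    and dense: "V \<subseteq> closure (E \<inter> V)"
    and dominating: "\<exists>v \<in> E \<inter> V. \<exists>r::real. 0 < r \<and> r < 1 \<and>
      (\<forall>\<rho>. 0 < norm \<rho> \<and> norm \<rho> < r \<longrightarrow>
        phi smul \<mu> K (u - v) \<rho> = (SUP z \<in> {u - w | w. w \<in> E \<inter> V}. phi smul \<mu> K z \<rho>))"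
  shows "local_weak_mode smul \<mu> K E V u \<longleftrightarrow> local_strong_mode smul \<mu> K V u"
proof -
  interpret topological_vector_space smul by (rule tvs)
  let ?\<phi> = "phi smul \<mu> K"
  define M where "M \<rho> = (SUP z \<in> {u - v | v. v \<in> V}. ?\<phi> z \<rho>)" for \<rho>
  have le_M: "?\<phi> (u - v) \<rho> \<le> M \<rho>" if "v \<in> V" for v \<rho>
    unfolding M_def using that by (intro SUP_upper) auto
  have strong_iff: "local_strong_mode smul \<mu> K V u \<longleftrightarrow> ((\<lambda>\<rho>. ratio (M \<rho>) (?\<phi> u \<rho>)) \<longlongrightarrow> 1) (at 0)"
    by (simp add: local_strong_mode_def M_def)
  show ?thesis
  proof
    assume weak: "local_weak_mode smul \<mu> K E V u"
    obtain v r where v: "v \<in> E \<inter> V" and r: "0 < r"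
      and dom: "\<And>\<rho>. 0 < norm \<rho> \<Longrightarrow> norm \<rho> < r \<Longrightarrow>
        ?\<phi> (u - v) \<rho> = (SUP z \<in> {u - w | w. w \<in> E \<inter> V}. ?\<phi> z \<rho>)"
      using dominating by blast
    have "?\<phi> (u - v) \<rho> = M \<rho>" if "\<rho> \<noteq> 0" "norm \<rho> < r" for \<rho>
      unfolding M_def
      using dom[of \<rho>] that SUP_phi_dense[OF tvs borel K(1) that(1) _ dense, of u] by simp
    then have eq: "\<forall>\<^sub>F \<rho> in at 0. ?\<phi> (u - v) \<rho> = M \<rho>"
      unfolding eventually_at using r by (auto simp: dist_norm)
    have "Limsup (at 0) (\<lambda>\<rho>. ratio (M \<rho>) (?\<phi> u \<rho>))
        = Limsup (at 0) (\<lambda>\<rho>. ratio (?\<phi> (u - v) \<rho>) (?\<phi> u \<rho>))"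
      using eq by (intro Limsup_eq) (auto elim: eventually_mono)
    then have upper: "Limsup (at 0) (\<lambda>\<rho>. ratio (M \<rho>) (?\<phi> u \<rho>)) \<le> 1"
      using weak v by (simp add: local_weak_mode_def)
    have "1 \<le> ratio (M \<rho>) (?\<phi> u \<rho>)" if "\<rho> \<noteq> 0" for \<rho>
      using le_M[OF V(2)] phi_finite[OF finite_bounded K(1,3) that]
      by (intro one_le_ratio) auto
    then have "1 \<le> Liminf (at 0) (\<lambda>\<rho>. ratio (M \<rho>) (?\<phi> u \<rho>))"
      by (intro Liminf_bounded) (auto simp: eventually_at_filter)
    then show "local_strong_mode smul \<mu> K V u"
      unfolding strong_iff using upper Liminf_le_Limsup[of "at (0::'k)"]
      by (intro Liminf_eq_Limsup) (auto intro: antisym order_trans)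
  next
    assume "local_strong_mode smul \<mu> K V u"
    then have lim: "((\<lambda>\<rho>. ratio (M \<rho>) (?\<phi> u \<rho>)) \<longlongrightarrow> 1) (at 0)"
      by (simp add: strong_iff)
    show "local_weak_mode smul \<mu> K E V u"
      unfolding local_weak_mode_def
    proof (intro conjI ballI)
      show "u \<in> measure_supp \<mu>"
        unfolding measure_supp_def
      proof (intro CollectI allI impI, rule ccontr)
        fix U assume U: "open U \<and> u \<in> U" and "\<not> emeasure \<mu> U > 0"
        then have null: "emeasure \<mu> U = 0"
          by simp
        have "\<forall>\<^sub>F \<rho> in at 0. ratio (M \<rho>) (?\<phi> u \<rho>) = \<infinity>"
        proof (rule eventually_mono)
          show "\<forall>\<^sub>F \<rho> in at 0. (\<lambda>k. u + smul \<rho> k) ` K \<subseteq> U"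
            using U by (intro eventually_scaled_translate_subset K(3)) auto
        next
          fix \<rho> assume "(\<lambda>k. u + smul \<rho> k) ` K \<subseteq> U"
          then have "?\<phi> u \<rho> \<le> emeasure \<mu> U"
            unfolding phi_def using U by (intro emeasure_mono) (auto simp: borel)
          then show "ratio (M \<rho>) (?\<phi> u \<rho>) = \<infinity>"
            using null by (simp add: ratio_def)
        qed
        moreover have "\<forall>\<^sub>F \<rho> in at 0. ratio (M \<rho>) (?\<phi> u \<rho>) < \<infinity>"
          using lim by (rule order_tendstoD) simp
        ultimately have "\<forall>\<^sub>F \<rho> in at (0::'k). False"
          by eventually_elim simp
        then show False
          by simp
      qed
      fix v assume "v \<in> E \<inter> V"
      then have "Limsup (at 0) (\<lambda>\<rho>. ratio (?\<phi> (u - v) \<rho>) (?\<phi> u \<rho>))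
          \<le> Limsup (at 0) (\<lambda>\<rho>. ratio (M \<rho>) (?\<phi> u \<rho>))"
        using le_M by (intro Limsup_mono always_eventually allI ratio_mono) auto
      also have "\<dots> = 1"
        using lim by (intro lim_imp_Limsup) auto
      finally show "Limsup (at 0) (\<lambda>\<rho>. ratio (?\<phi> (u - v) \<rho>) (?\<phi> u \<rho>)) \<le> 1" .
    qed
  qed
qed

end
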